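(* Let $N\ge 2$, $k\in\{2,\dots,N\}$, $\varepsilon\in[0,1)$, let $I\subset\mathbb{R}$ be a compact interval and $f:I\to I$ a piecewise $C^1$ map such that $$\sup|f'|<(1-\varepsilon)^{\frac{k-N}{N-k+1}}.$$ Let $\tilde F_\varepsilon:I^{N-k+1}\to I^{N-k+1}$ be the reduced coupled map lattice describing the dynamics, on a cluster space of size $k$, of the globally coupled map lattice with $N$ sites, local map $f$ and coupling $\varepsilon$. Then the non-wandering set $\Omega$ of $\tilde F_\varepsilon$ has zero $(N-k+1)$-dimensional Lebesgue measure.
   Context: The globally coupled map lattice on $I^N$ is $F_\varepsilon(x)_i=(1-\varepsilon)f(x_i)+\frac{\varepsilon}{N}\sum_{j=1}^N f(x_j)$, $1\le i\le N$. For $J\subset\{1,\dots,N\}$ with $\#J=k$, the cluster space $\mathcal{C}_J=\{x\in I^N: x_i=x_j\ \forall i,j\in J\}$ is forward invariant, and the restriction of $F_\varepsilon$ to $\mathcal{C}_J$ is identified with the map $\tilde F_\varepsilon$ on $\tilde X=I^{N-k+1}$ (the first coordinate $\tilde x_1$ being the common value of the sites in $J$) defined by $$\tilde F_\varepsilon(\tilde x)_i=(1-\varepsilon)f(\tilde x_i)+\frac{\varepsilon}{N}\Big(k f(\tilde x_1)+\sum_{j=2}^{N-k+1} f(\tilde x_j)\Big),\qquad 1\le i\le N-k+1.$$ Piecewise $C^1$ means that $I$ can be partitioned into finitely many intervals on the interior of each of which $f$ is $C^1$; $\sup|f'|$ is taken over the points where $f'$ is defined. The non-wandering set $\Omega$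 of $\tilde F_\varepsilon$ is the set of points $x\in\tilde X$ such that for any neighborhood $U$ of $x$ in $\tilde X$ and any $n_0\ge 1$, there exists $n\ge n_0$ such that $\tilde F_\varepsilon^{-n}(U)\cap U\ne\emptyset$. *)

theory Defs
  imports "HOL-Analysis.Analysis" "HOL-Library.Disjoint_Sets"
begin

text \<open>Unlike the library's \<open>piecewise_C1_differentiable_on\<close>, no continuity across the pieces is
  required, and nothing is assumed at their endpoints, not even bounded one-sided derivatives.\<close>

definition piecewise_C1_map :: "real set \<Rightarrow> (real \<Rightarrow> real) \<Rightarrow> bool" where
  "piecewise_C1_map I f \<longleftrightarrow>
     (\<exists>P. finite P \<and> partition_on I P \<and>
          (\<forall>J\<in>P. is_interval J \<and> f C1_differentiable_on (interior J)))"

text \<open>The supremum is taken in the extended reals, so that an unbounded derivative gives \<open>\<infinity>\<close>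
  rather than an unspecified real.  The values of \<open>f\<close> outside \<open>I\<close> are irrelevant; one-sided
  derivatives of \<open>f\<close> at the endpoints of \<open>I\<close>, if any, would not change the supremum for a
  piecewise \<open>C\<^sup>1\<close> map, by the mean value theorem.\<close>

definition sup_abs_deriv :: "real set \<Rightarrow> (real \<Rightarrow> real) \<Rightarrow> ereal" where
  "sup_abs_deriv I f =
     (SUP x\<in>{x \<in> interior I. f field_differentiable (at x)}. ereal \<bar>deriv f x\<bar>)"

definition cube :: "real set \<Rightarrow> (real ^ 'n) set" where
  "cube I = {x. \<forall>i. x $ i \<in> I}"

text \<open>The coordinates \<open>1, \<dots>, N - k + 1\<close> are indexed by a finite type \<open>'n\<close> with
  \<open>CARD('n) = N - k + 1\<close>; the index \<open>c\<close> plays the role of the first coordinate, i.e. of the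
  common value of the \<open>k\<close> synchronised sites.\<close>

definition reduced_map ::
  "nat \<Rightarrow> nat \<Rightarrow> real \<Rightarrow> (real \<Rightarrow> real) \<Rightarrow> 'n \<Rightarrow> real ^ 'n \<Rightarrow> real ^ 'n" where
  "reduced_map N k \<epsilon> f c x =
     (\<chi> i. (1 - \<epsilon>) * f (x $ i)
          + \<epsilon> / real N * (real k * f (x $ c) + (\<Sum>j\<in>UNIV - {c}. f (x $ j))))"

text \<open>\<open>F\<close> is regarded as a self-map of \<open>X\<close>: neighbourhoods are relative to \<open>X\<close> and preimages
  are cut down to \<open>X\<close>.\<close>

definition nonwandering_set ::
  "'a::topological_space set \<Rightarrow> ('a \<Rightarrow> 'a) \<Rightarrow> 'a set" where
  "nonwandering_set X F =
     {x \<in> X. \<forall>U. openin (top_of_set X) U \<and> x \<in> U \<longrightarrow>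
        (\<forall>n0\<ge>1. \<exists>n\<ge>n0. ((F ^^ n) -` U \<inter> X) \<inter> U \<noteq> {})}"

end

theory Submission imports Defs begin

text \<open>The map is \<open>x \<mapsto> L (f x\<^sub>1, \<dots>, f x\<^sub>n)\<close> with \<open>L\<close> linear of determinant
  \<open>(1 - \<epsilon>)\<^sup>n\<^sup>-\<^sup>1\<close>, where \<open>n = N - k + 1\<close>.  The hypothesis on \<open>sup |f'|\<close> therefore says that
  volumes shrink by a factor \<open>\<theta> < 1\<close>.  Since \<open>f\<close> may jump, the non-wandering set need not lie
  in the images \<open>F\<^sup>m(X)\<close> of the cube, only in their closures.  But each branch of \<open>f\<close> is
  Lipschitz and extends to the closure of its piece, so the image of a compact set of volume
  \<open>v\<close> lies in a compact set of volume at most \<open>\<theta> v\<close>: the union of the images under the extended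
  branches and of a null set accounting for the finitely many break points.  Iterating, the
  non-wandering set lies in compact sets of volume at most \<open>\<theta>\<^sup>m\<close> times that of the cube.\<close>

subsection \<open>Volume scaling by the linear part\<close>

text \<open>For linear \<open>h\<close> the factor \<open>q\<close> is the absolute value of the
  determinant. Measurability of images is part of the property so that it survives composition,
  which reduces a map to its elementary factors.\<close>

definition scales_measure :: "real \<Rightarrow> ((real ^ 'n) \<Rightarrow> (real ^ 'n)) \<Rightarrow> bool" where
  "scales_measure q h \<longleftrightarrow>
     (\<forall>S\<in>lmeasurable. h ` S \<in> lmeasurable \<and> measure lebesgue (h ` S) = q * measure lebesgue S)"

lemma scales_measure_comp:
  assumes "scales_measure p g" "scales_measure q h"
  shows "scales_measure (p * q) (\<lambda>x. g (h x))"
  using assms by (simp add: scales_measure_def flip: image_image)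

lemma scales_measure_stretch: "scales_measure \<bar>prod t UNIV\<bar> (\<lambda>x. \<chi> i. t i * x $ i)"
  by (simp add: scales_measure_def measurable_stretch measure_stretch)

text \<open>A linear map that preserves the volume of every box preserves that of every set of
  finite volume, so only boxes have to be checked.\<close>

lemma scales_measure_unit_shear:
  fixes m n :: "'n::finite"
  assumes "m \<noteq> n"
  shows "scales_measure 1 (\<lambda>x. \<chi> i. if i = m then x $ m + x $ n else x $ i)"
proof -
  define h where "h = (\<lambda>x::real^'n. \<chi> i. if i = m then x $ m + x $ n else x $ i)"
  have lin: "linear h"
    by (rule linearI) (auto simp: h_def vec_eq_iff algebra_simps)
  have "measure lebesgue (h ` cbox a b) = measure lebesgue (cbox a b)" for a b
  proof (cases "cbox a b = {}")
    case False
    \<comment> \<open>The volume formula for sheared boxes asks for a nonnegative lower bound in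
      coordinate \<open>n\<close>. Translation by \<open>v\<close> makes this bound 0, and by
      linearity it only translates the image.\<close>
    define v :: "real^'n" where "v = (\<chi> i. if i = n then - a $ n else 0)"
    have "cbox (v + a) (v + b) \<noteq> {}"
      using False by (simp add: cbox_translation)
    then have "measure lebesgue (h ` cbox (v + a) (v + b)) = measure lebesgue (cbox (v + a) (v + b))"
      unfolding h_def by (rule measure_shear_interval[OF assms]) (simp add: v_def)
    moreover have "h ` cbox (v + a) (v + b) = (+) (h v) ` h ` cbox a b"
      by (simp add: cbox_translation image_image linear_add[OF lin])
    ultimately show ?thesis
      using measure_translation[of "h v" "h ` cbox a b"] measure_translation[of v "cbox a b"]
      by (simp only: cbox_translation[symmetric])
  qed simp
  then have "h ` S \<in> lmeasurable \<and> 1 * measure lebesgue S = measure lebesgue (h ` S)"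
    if "S \<in> lmeasurable" for S
    using measure_linear_sufficient[OF lin that, of 1] unfolding mult_1 by blast
  then have "scales_measure 1 h"
    unfolding scales_measure_def mult_1 by metis
  then show ?thesis
    unfolding h_def .
qed

text \<open>For \<open>t \<noteq> 0\<close> this is the unit shear conjugated by the stretch of
  coordinate \<open>n\<close> by \<open>t\<close>; the two stretch factors cancel.\<close>

lemma scales_measure_shear:
  fixes m n :: "'n::finite"
  assumes "m \<noteq> n"
  shows "scales_measure 1 (\<lambda>x. \<chi> i. if i = m then x $ m + t * x $ n else x $ i)"
proof (cases "t = 0")
  case True
  then have "(\<lambda>x::real^'n. \<chi> i. if i = m then x $ m + t * x $ n else x $ i) = (\<lambda>x. x)"
    by (auto simp: vec_eq_iff fun_eq_iff)
  then show ?thesis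
    by (simp add: scales_measure_def)
next
  case False
  let ?d = "\<lambda>s i. if i = n then s else (1::real)"
  let ?S = "\<lambda>s (x::real^'n). \<chi> i. ?d s i * x $ i"
  let ?h = "\<lambda>x::real^'n. \<chi> i. if i = m then x $ m + x $ n else x $ i"
  have d: "prod (?d s) UNIV = s" for s
    by simp
  have "scales_measure (\<bar>1 / t\<bar> * (1 * \<bar>t\<bar>)) (\<lambda>x. ?S (1 / t) (?h (?S t x)))"
    using scales_measure_comp[OF scales_measure_stretch[of "?d (1 / t)"]
        scales_measure_comp[OF scales_measure_unit_shear[OF assms] scales_measure_stretch[of "?d t"]]]
    unfolding d .
  moreover have "(\<lambda>x. ?S (1 / t) (?h (?S t x)))
      = (\<lambda>x. \<chi> i. if i = m then x $ m + t * x $ n else x $ i)"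
    using False assms by (auto simp: vec_eq_iff fun_eq_iff)
  ultimately show ?thesis
    using False by (simp add: abs_mult[symmetric])
qed

text \<open>One elementary shear per index in \<open>J\<close>. As \<open>c\<close> is not in
  \<open>J\<close>, no shear changes a coordinate that another one reads, so the contributions add
  up.\<close>

lemma scales_measure_row_shear:
  fixes c :: "'n::finite"
  assumes "c \<notin> J"
  shows "scales_measure 1 (\<lambda>x. \<chi> i. if i = c then x $ c + t * (\<Sum>j\<in>J. x $ j) else x $ i)"
proof -
  have "finite J"
    by simp
  then show ?thesis
    using assms
  proof (induction J)
    case empty
    have "(\<lambda>x::real^'n. \<chi> i. if i = c then x $ c + t * (\<Sum>j\<in>{}. x $ j) else x $ i) = (\<lambda>x. x)"
      by (auto simp: vec_eq_iff fun_eq_iff)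
    then show ?case
      by (simp add: scales_measure_def)
  next
    case (insert k J)
    let ?h = "\<lambda>J (x::real^'n). \<chi> i. if i = c then x $ c + t * (\<Sum>j\<in>J. x $ j) else x $ i"
    let ?s = "\<lambda>x::real^'n. \<chi> i. if i = c then x $ c + t * x $ k else x $ i"
    have "?h (insert k J) = (\<lambda>x. ?s (?h J x))"
      using insert.hyps insert.prems by (auto simp: vec_eq_iff fun_eq_iff algebra_simps)
    moreover have "scales_measure (1 * 1) (\<lambda>x. ?s (?h J x))"
      using insert by (intro scales_measure_comp scales_measure_shear) auto
    ultimately show ?case
      by simp
  qed
qed

lemma scales_measure_column_shear:
  fixes c :: "'n::finite"
  assumes "c \<notin> J"
  shows "scales_measure 1 (\<lambda>x. \<chi> i. if i \<in> J then x $ i + t * x $ c else x $ i)"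
proof -
  have "finite J"
    by simp
  then show ?thesis
    using assms
  proof (induction J)
    case empty
    show ?case
      by (simp add: scales_measure_def)
  next
    case (insert k J)
    let ?h = "\<lambda>J (x::real^'n). \<chi> i. if i \<in> J then x $ i + t * x $ c else x $ i"
    let ?s = "\<lambda>x::real^'n. \<chi> i. if i = k then x $ k + t * x $ c else x $ i"
    have "?h (insert k J) = (\<lambda>x. ?s (?h J x))"
      using insert.hyps insert.prems by (auto simp: vec_eq_iff fun_eq_iff)
    moreover have "scales_measure (1 * 1) (\<lambda>x. ?s (?h J x))"
      using insert by (intro scales_measure_comp scales_measure_shear) auto
    ultimately show ?case
      by simp
  qed
qed

text \<open>The linear part of \<open>reduced_map\<close>, which arises for
  \<open>\<alpha> = 1 - \<epsilon>\<close>, \<open>\<beta> = \<epsilon> / real N\<close> and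
  \<open>\<kappa> = real k\<close>.\<close>

definition mean_field :: "real \<Rightarrow> real \<Rightarrow> real \<Rightarrow> 'n::finite \<Rightarrow> real ^ 'n \<Rightarrow> real ^ 'n" where
  "mean_field \<alpha> \<beta> \<kappa> c x = (\<chi> i. \<alpha> * x $ i + \<beta> * (\<kappa> * x $ c + (\<Sum>j\<in>UNIV - {c}. x $ j)))"

lemma continuous_on_mean_field: "continuous_on S (mean_field \<alpha> \<beta> \<kappa> c)"
  unfolding mean_field_def by (intro continuous_intros)

text \<open>In the coordinates \<open>x\<^sub>c\<close> and \<open>x\<^sub>i - x\<^sub>c\<close> for \<open>i \<noteq> c\<close> the map is triangular, with diagonal
  entries \<open>1\<close> and \<open>\<alpha>, \<dots>, \<alpha>\<close>.  Shears replace \<open>measure_linear_image\<close>, which requires the index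
  type to be well-ordered.\<close>

lemma scales_measure_mean_field:
  fixes c :: "'n::finite"
  assumes "\<alpha> + \<beta> * (\<kappa> + real (CARD('n) - 1)) = 1" "\<alpha> \<ge> 0"
  shows "scales_measure (\<alpha> ^ (CARD('n) - 1)) (mean_field \<alpha> \<beta> \<kappa> c)"
proof -
  let ?J = "UNIV - {c}"
  let ?col = "\<lambda>t (x::real^'n). \<chi> i. if i \<in> ?J then x $ i + t * x $ c else x $ i"
  let ?row = "\<lambda>x::real^'n. \<chi> i. if i = c then x $ c + \<beta> * (\<Sum>j\<in>?J. x $ j) else x $ i"
  let ?d = "\<lambda>i. if i = c then 1 else \<alpha>"
  let ?S = "\<lambda>x::real^'n. \<chi> i. ?d i * x $ i"
  have "prod ?d UNIV = \<alpha> ^ (CARD('n) - 1)"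
    by (simp add: prod.remove[of _ c])
  then have "scales_measure \<bar>\<alpha> ^ (CARD('n) - 1)\<bar> ?S"
    using scales_measure_stretch[of ?d] by metis
  \<comment> \<open>From the inside outwards: pass to the differences \<open>x $ i - x $ c\<close>,
    add their multiples to coordinate \<open>c\<close>, scale all the other coordinates by
    \<open>\<alpha>\<close>, and undo the first change of coordinates.\<close>
  then have "scales_measure (1 * (\<bar>\<alpha> ^ (CARD('n) - 1)\<bar> * (1 * 1))) (\<lambda>x. ?col 1 (?S (?row (?col (-1) x))))"
    by (intro scales_measure_comp[OF scales_measure_column_shear] scales_measure_comp
        scales_measure_row_shear scales_measure_column_shear) auto
  moreover have "?col 1 (?S (?row (?col (-1) x))) = mean_field \<alpha> \<beta> \<kappa> c x" for x
  proof -
    \<comment> \<open>The two sides of the claim differ by a multiple of 1 minus the row sum of the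
      matrix, which vanishes by assumption.\<close>
    have "x $ c + \<beta> * (\<Sum>j\<in>?J. x $ j - x $ c)
        = \<alpha> * x $ c + \<beta> * (\<kappa> * x $ c + (\<Sum>j\<in>?J. x $ j)) + x $ c * (1 - (\<alpha> + \<beta> * (\<kappa> + real (CARD('n) - 1))))"
      by (simp add: sum_subtractf algebra_simps)
    then have "x $ c + \<beta> * (\<Sum>j\<in>?J. x $ j - x $ c)
        = \<alpha> * x $ c + \<beta> * (\<kappa> * x $ c + (\<Sum>j\<in>?J. x $ j))"
      using assms by simp
    moreover have "(\<Sum>j\<in>?J. if j = c then x $ j else x $ j - x $ c) = (\<Sum>j\<in>?J. x $ j - x $ c)"
      by (rule sum.cong) auto
    ultimately show ?thesis
      by (auto simp: mean_field_def vec_eq_iff algebra_simps)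
  qed
  ultimately show ?thesis
    using assms(2) by simp
qed

subsection \<open>Volumes under coordinatewise Lipschitz maps\<close>

lemma compact_image_coordinatewise:
  fixes g :: "'n::finite \<Rightarrow> real \<Rightarrow> real"
  assumes "\<And>i. continuous_on {l $ i..u $ i} (g i)" "compact S" "S \<subseteq> cbox l u"
  shows "compact ((\<lambda>x. \<chi> i. g i (x $ i)) ` S)"
proof (rule compact_continuous_image)
  show "continuous_on S (\<lambda>x. \<chi> i. g i (x $ i))"
    using assms(3) by (intro continuous_intros continuous_on_compose2[OF assms(1)]) (auto simp: mem_box_cart)
qed fact

text \<open>Each side of the box is mapped into the interval between the minimum and the maximum of
  \<open>g i\<close>, of length at most \<open>C\<close> times the side. The image thus lies in a
  box, whose volume is the product of these lengths.\<close>

lemma measure_coordinatewise_lipschitz_cbox: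
  fixes g :: "'n::finite \<Rightarrow> real \<Rightarrow> real"
  assumes lip: "\<And>i. C-lipschitz_on {l $ i..u $ i} (g i)"
  shows "measure lebesgue ((\<lambda>x. \<chi> i. g i (x $ i)) ` cbox l u) \<le> C ^ CARD('n) * measure lebesgue (cbox l u)"
proof (cases "cbox l u = {}")
  case False
  then have lu: "l $ i \<le> u $ i" for i
    by (simp add: interval_ne_empty_cart)
  have "\<exists>p q. p \<le> q \<and> q - p \<le> C * (u $ i - l $ i) \<and> g i ` {l $ i..u $ i} \<subseteq> {p..q}" for i
  proof -
    have cont: "continuous_on {l $ i..u $ i} (g i)"
      by (rule lipschitz_on_continuous_on[OF lip])
    obtain x where x: "x \<in> {l $ i..u $ i}" "\<forall>y\<in>{l $ i..u $ i}. g i x \<le> g i y"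
      using continuous_attains_inf[OF _ _ cont] lu by fastforce
    obtain z where z: "z \<in> {l $ i..u $ i}" "\<forall>y\<in>{l $ i..u $ i}. g i y \<le> g i z"
      using continuous_attains_sup[OF _ _ cont] lu by fastforce
    have "g i z - g i x \<le> dist (g i z) (g i x)"
      by (simp add: dist_real_def)
    also have "\<dots> \<le> C * dist z x"
      using lipschitz_onD[OF lip] x z by blast
    also have "\<dots> \<le> C * (u $ i - l $ i)"
      using x z lipschitz_on_nonneg[OF lip] by (intro mult_left_mono) (auto simp: dist_real_def)
    finally show ?thesis
      using x z by (intro exI[of _ "g i x"] exI[of _ "g i z"]) auto
  qed
  then obtain p q where pq: "\<And>i. p i \<le> q i" "\<And>i. q i - p i \<le> C * (u $ i - l $ i)"
      "\<And>i. g i ` {l $ i..u $ i} \<subseteq> {p i..q i}"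
    by metis
  let ?P = "\<lambda>x::real^'n. \<chi> i. g i (x $ i)"
  have "?P ` cbox l u \<subseteq> cbox (\<chi> i. p i) (\<chi> i. q i)"
    using pq(3) by (fastforce simp: mem_box_cart image_subset_iff)
  moreover have "compact (?P ` cbox l u)"
    by (rule compact_image_coordinatewise[OF lipschitz_on_continuous_on[OF lip]]) auto
  ultimately have "measure lebesgue (?P ` cbox l u) \<le> measure lebesgue (cbox (\<chi> i. p i) (\<chi> i. q i))"
    by (intro measure_mono_fmeasurable) (auto intro: lmeasurable_compact fmeasurableD)
  also have "\<dots> = (\<Prod>i\<in>UNIV. q i - p i)"
    using pq(1) by (simp add: content_cbox_if_cart interval_eq_empty_cart not_less) (metis not_le)
  also have "\<dots> \<le> (\<Prod>i\<in>UNIV. C * (u $ i - l $ i))"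
    using pq by (intro prod_mono) auto
  also have "\<dots> = C ^ CARD('n) * measure lebesgue (cbox l u)"
    using False by (simp add: prod.distrib content_cbox_cart)
  finally show ?thesis .
qed simp

text \<open>The set is covered by countably many boxes with disjoint interiors and total volume
  arbitrarily close to its own; the bound for boxes is then summed.\<close>

lemma measure_coordinatewise_lipschitz:
  fixes g :: "'n::finite \<Rightarrow> real \<Rightarrow> real"
  assumes lip: "\<And>i. C-lipschitz_on {l $ i..u $ i} (g i)"
    and S: "compact S" "S \<subseteq> cbox l u"
  shows "measure lebesgue ((\<lambda>x. \<chi> i. g i (x $ i)) ` S) \<le> C ^ CARD('n) * measure lebesgue S"
proof (rule field_le_epsilon)
  let ?P = "\<lambda>x::real^'n. \<chi> i. g i (x $ i)"
  have C: "C \<ge> 0"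
    using lip lipschitz_on_nonneg by blast
  fix e :: real
  assume "e > 0"
  \<comment> \<open>The summand 1 keeps the denominator positive also for
    \<open>C = 0\<close>.\<close>
  define d where "d = e / (C ^ CARD('n) + 1)"
  have d: "d > 0" "C ^ CARD('n) * d \<le> e"
  proof -
    have "C ^ CARD('n) + 1 > 0"
      using C by (simp add: add_nonneg_pos)
    then show "d > 0" "C ^ CARD('n) * d \<le> e"
      using \<open>e > 0\<close> by (auto simp: d_def field_simps)
  qed
  obtain \<D> where \<D>: "countable \<D>" "\<And>K. K \<in> \<D> \<Longrightarrow> K \<subseteq> cbox l u \<and> K \<noteq> {} \<and> (\<exists>c d. K = cbox c d)"
      "pairwise (\<lambda>A B. interior A \<inter> interior B = {}) \<D>" "S \<subseteq> \<Union>\<D>" "\<Union>\<D> \<in> lmeasurable"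
      "measure lebesgue (\<Union>\<D>) \<le> measure lebesgue S + d"
    using measurable_outer_intervals_bounded[OF lmeasurable_compact[OF S(1)] S(2) d(1)] by metis
  have meas: "K \<in> lmeasurable" if "K \<in> \<D>" for K
    using \<D>(2)[OF that] by auto
  have measP: "?P ` K \<in> lmeasurable" if "K \<in> \<D>" for K
    using \<D>(2)[OF that]
    by (metis compact_image_coordinatewise[OF lipschitz_on_continuous_on[OF lip]] compact_cbox lmeasurable_compact)
  have leP: "measure lebesgue (?P ` K) \<le> C ^ CARD('n) * measure lebesgue K" if "K \<in> \<D>" for K
  proof -
    obtain c d where K: "K = cbox c d" "cbox c d \<subseteq> cbox l u"
      using \<D>(2)[OF \<open>K \<in> \<D>\<close>] by blast
    have "{c $ i..d $ i} \<subseteq> {l $ i..u $ i}" for i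
      using \<D>(2)[OF that] K subset_interval_cart(1)[of c d l u]
      by (auto simp: interval_ne_empty_cart)
    then show ?thesis
      unfolding K by (intro measure_coordinatewise_lipschitz_cbox lipschitz_on_subset[OF lip])
  qed
  \<comment> \<open>A bound uniform over finite subfamilies yields both the measurability and the
    volume bound of the countable union.\<close>
  have bound: "measure lebesgue (\<Union>K\<in>\<F>. ?P ` K) \<le> C ^ CARD('n) * (measure lebesgue S + d)"
    if \<F>: "\<F> \<subseteq> \<D>" "finite \<F>" for \<F>
  proof -
    have "measure lebesgue (\<Union>K\<in>\<F>. ?P ` K) \<le> (\<Sum>K\<in>\<F>. measure lebesgue (?P ` K))"
      using that measP by (intro measure_UNION_le) (auto intro: fmeasurableD)
    also have "\<dots> \<le> (\<Sum>K\<in>\<F>. C ^ CARD('n) * measure lebesgue K)"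
      using leP \<F> by (intro sum_mono) auto
    also have "\<dots> = C ^ CARD('n) * measure lebesgue (\<Union>\<F>)"
    proof -
      \<comment> \<open>Two boxes of the cover meet in a convex set with empty interior, hence in a
        null set, so volumes add.\<close>
      have "pairwise (\<lambda>S T. negligible (S \<inter> T)) \<F>"
        unfolding pairwise_def
      proof (intro ballI impI)
        fix A B
        assume AB: "A \<in> \<F>" "B \<in> \<F>" "A \<noteq> B"
        then obtain a b c d where *: "A = cbox a b" "B = cbox c d"
          using \<D>(2) \<F> by (metis subsetD)
        have "interior (A \<inter> B) = {}"
          using AB \<D>(3) \<F> unfolding interior_Int pairwise_def by blast
        moreover have "convex (A \<inter> B)"
          unfolding * by (intro convex_Int convex_box)
        ultimately show "negligible (A \<inter> B)"
          using negligible_convex_interior by blast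
      qed
      then show ?thesis
        using that meas by (subst measure_negligible_finite_Union) (auto simp: sum_distrib_left)
    qed
    also have "\<dots> \<le> C ^ CARD('n) * (measure lebesgue S + d)"
    proof (rule mult_left_mono)
      have "measure lebesgue (\<Union>\<F>) \<le> measure lebesgue (\<Union>\<D>)"
        using \<F> meas \<D>(5) by (intro measure_mono_fmeasurable) (auto intro!: sets.finite_Union fmeasurableD)
      then show "measure lebesgue (\<Union>\<F>) \<le> measure lebesgue S + d"
        using \<D>(6) by linarith
    qed (use C in simp)
    finally show ?thesis .
  qed
  have "measure lebesgue (?P ` S) \<le> measure lebesgue (\<Union>K\<in>\<D>. ?P ` K)"
  proof (rule measure_mono_fmeasurable)
    show "?P ` S \<in> sets lebesgue"
      using compact_image_coordinatewise[OF lipschitz_on_continuous_on[OF lip] S]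
      by (auto intro: lmeasurable_compact fmeasurableD)
    show "(\<Union>K\<in>\<D>. ?P ` K) \<in> lmeasurable"
      by (rule fmeasurable_UN_bound[OF \<D>(1) measP bound])
  qed (use \<D>(4) in blast)
  also have "\<dots> \<le> C ^ CARD('n) * (measure lebesgue S + d)"
    by (rule measure_UN_bound[OF \<D>(1) measP bound])
  also have "\<dots> \<le> C ^ CARD('n) * measure lebesgue S + e"
    using d by (simp add: algebra_simps)
  finally show "measure lebesgue (?P ` S) \<le> C ^ CARD('n) * measure lebesgue S + e" .
qed

subsection \<open>Branches of a piecewise differentiable map\<close>

text \<open>The closure is a compact interval, and a convex set has the same interior as its
  closure. A one-point piece gives \<open>l = u\<close>.\<close>

lemma interior_bounded_interval:
  fixes J :: "real set"
  assumes J: "is_interval J" "J \<subseteq> {a..b}" "J \<noteq> {}"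
  obtains l u where "interior J = {l<..<u}" "J \<subseteq> {l..u}"
proof -
  have "compact (closure J)"
    using J(2) bounded_subset[OF bounded_closed_interval] by (simp add: compact_closure)
  moreover have "is_interval (closure J)"
    using J(1) by (simp add: is_interval_convex_1 convex_closure)
  ultimately obtain l u where lu: "closure J = cbox l u"
    using is_interval_compact by blast
  show ?thesis
  proof
    have "interior J = interior (closure J)"
      using J(1) by (simp add: is_interval_convex_1 convex_interior_closure)
    then show "interior J = {l<..<u}"
      unfolding lu by (simp add: box_real)
    show "J \<subseteq> {l..u}"
      using closure_subset[of J] unfolding lu by simp
  qed
qed

text \<open>Mean value inequality: every point of the piece is among those over which
  \<open>sup_abs_deriv\<close> is taken.\<close>

lemma lipschitz_on_C1_piece:
  assumes C1: "f C1_differentiable_on {l<..<u}" "{l<..<u} \<subseteq> interior I"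
    and C: "sup_abs_deriv I f \<le> ereal C" "C \<ge> 0"
  shows "C-lipschitz_on {l<..<u} f"
proof -
  obtain D where D: "\<And>x. x \<in> {l<..<u} \<Longrightarrow> (f has_real_derivative D x) (at x)"
    using C1(1) unfolding C1_differentiable_on_def has_real_derivative_iff_has_vector_derivative by blast
  show ?thesis
  proof (rule bounded_derivative_imp_lipschitz)
    fix x
    assume x: "x \<in> {l<..<u}"
    show "(f has_derivative (*) (D x)) (at x within {l<..<u})"
      using D[OF x] has_derivative_at_withinI unfolding has_field_derivative_def by blast
    have "ereal \<bar>deriv f x\<bar> \<le> sup_abs_deriv I f"
      unfolding sup_abs_deriv_def
      using x C1(2) D[OF x] by (intro SUP_upper) (auto simp: field_differentiable_def)
    then have "\<bar>D x\<bar> \<le> C"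
      using DERIV_imp_deriv[OF D[OF x]] C(1) by (metis ereal_less_eq(3) order_trans)
    then show "onorm ((*) (D x)) \<le> C"
      by (intro onorm_le) (auto simp: abs_mult intro: mult_right_mono)
  qed (use C in auto)
qed

text \<open>On each open piece \<open>f\<close> is \<open>C\<close>-Lipschitz, so it extends to the
  closed piece with the same constant. The extension \<open>g J\<close> may differ from
  \<open>f\<close> at the endpoints, where \<open>f\<close> can jump.\<close>

lemma piecewise_C1_map_lipschitz_pieces:
  assumes f: "piecewise_C1_map {a..b} f"
    and C: "sup_abs_deriv {a..b} f \<le> ereal C" "C \<ge> 0"
  obtains Q :: "real set set" and l u g where
    "finite Q" "disjoint_family_on (\<lambda>J. {l J<..<u J}) Q"
    "finite ({a..b} - (\<Union>J\<in>Q. {l J<..<u J}))"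
    "\<forall>J\<in>Q. C-lipschitz_on {l J..u J} (g J)"
    "\<forall>J\<in>Q. \<forall>x\<in>{l J<..<u J}. g J x = f x"
proof -
  obtain P where P: "finite P" "partition_on {a..b} P"
      "\<And>J. J \<in> P \<Longrightarrow> is_interval J" "\<And>J. J \<in> P \<Longrightarrow> f C1_differentiable_on interior J"
    using f unfolding piecewise_C1_map_def by blast
  have sub: "J \<subseteq> {a..b}" and ne: "J \<noteq> {}" if "J \<in> P" for J
    using P(2) that by (auto simp: partition_on_def)
  have "\<exists>l u. interior J = {l<..<u} \<and> J \<subseteq> {l..u}" if "J \<in> P" for J
    using interior_bounded_interval[OF P(3) sub ne] that by metis
  then obtain l u where lu: "\<And>J. J \<in> P \<Longrightarrow> interior J = {l J<..<u J}" "\<And>J. J \<in> P \<Longrightarrow> J \<subseteq> {l J..u J}"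
    by metis
  \<comment> \<open>Pieces without interior are dropped; their points join the finite exceptional
    set.\<close>
  define Q where "Q = {J\<in>P. l J < u J}"
  have "\<exists>g. C-lipschitz_on {l J..u J} g \<and> (\<forall>x\<in>{l J<..<u J}. g x = f x)" if "J \<in> Q" for J
  proof -
    have J: "J \<in> P" "l J < u J"
      using that by (auto simp: Q_def)
    have "C-lipschitz_on {l J<..<u J} f"
      using P(4)[OF J(1)] lu(1)[OF J(1)] interior_mono[OF sub[OF J(1)]] C
      by (intro lipschitz_on_C1_piece) auto
    then show ?thesis
      using lipschitz_extend_closure[of C "{l J<..<u J}" f] J(2) by (simp add: closure_greaterThanLessThan)
  qed
  then obtain g where g: "\<And>J. J \<in> Q \<Longrightarrow> C-lipschitz_on {l J..u J} (g J)"
      "\<And>J x. J \<in> Q \<Longrightarrow> x \<in> {l J<..<u J} \<Longrightarrow> g J x = f x"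
    by metis
  show thesis
  proof (rule that[of Q l u g])
    show "finite Q"
      using P(1) by (simp add: Q_def)
    show "disjoint_family_on (\<lambda>J. {l J<..<u J}) Q"
      unfolding disjoint_family_on_def
    proof (intro ballI impI)
      fix J K
      assume JK: "J \<in> Q" "K \<in> Q" "J \<noteq> K"
      then have "J \<inter> K = {}"
        using P(2) by (auto simp: Q_def partition_on_def disjoint_def)
      then show "{l J<..<u J} \<inter> {l K<..<u K} = {}"
        using JK lu(1)[of J] lu(1)[of K] interior_subset[of J] interior_subset[of K]
        unfolding Q_def by blast
    qed
    have "{a..b} - (\<Union>J\<in>Q. {l J<..<u J}) \<subseteq> (\<Union>J\<in>P. {l J, u J})"
    proof
      fix x
      assume x: "x \<in> {a..b} - (\<Union>J\<in>Q. {l J<..<u J})"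
      then have "x \<in> \<Union>P"
        using P(2) by (simp add: partition_on_def)
      then obtain J where J: "J \<in> P" "x \<in> J"
        by blast
      then have "x \<in> {l J..u J}"
        using lu(2) by blast
      moreover have "x \<notin> {l J<..<u J}"
        using J(1) x by (cases "l J < u J") (auto simp: Q_def)
      ultimately have "x = l J \<or> x = u J"
        by auto
      then show "x \<in> (\<Union>J\<in>P. {l J, u J})"
        using J(1) by blast
    qed
    then show "finite ({a..b} - (\<Union>J\<in>Q. {l J<..<u J}))"
      by (rule finite_subset) (use P(1) in auto)
  qed (use g in auto)
qed

subsection \<open>Volume contraction and the non-wandering set\<close>

lemma nonwandering_set_null:
  fixes F :: "'a::euclidean_space \<Rightarrow> 'a"
  assumes X: "compact X" and F: "F ` X \<subseteq> X" and \<theta>: "0 \<le> \<theta>" "\<theta> < 1"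
    and contr: "\<And>A. compact A \<Longrightarrow> A \<subseteq> X \<Longrightarrow>
      \<exists>B. compact B \<and> F ` A \<subseteq> B \<and> measure lebesgue B \<le> \<theta> * measure lebesgue A"
  shows "nonwandering_set X F \<in> null_sets lebesgue"
proof -
  have iter: "\<exists>B. compact B \<and> B \<subseteq> X \<and> (F ^^ n) ` X \<subseteq> B \<and> measure lebesgue B \<le> \<theta> ^ n * measure lebesgue X" for n
  proof (induction n)
    case 0
    then show ?case
      using X by auto
  next
    case (Suc n)
    then obtain A where A: "compact A" "A \<subseteq> X" "(F ^^ n) ` X \<subseteq> A"
        "measure lebesgue A \<le> \<theta> ^ n * measure lebesgue X"
      by blast
    then obtain B where B: "compact B" "F ` A \<subseteq> B" "measure lebesgue B \<le> \<theta> * measure lebesgue A"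
      using contr[OF A(1,2)] by blast
    have "(F ^^ Suc n) ` X = F ` (F ^^ n) ` X"
      by (simp only: funpow.simps image_comp)
    \<comment> \<open>Intersecting with \<open>X\<close> keeps the cover inside the domain of
      \<open>contr\<close>, so that the induction can go on.\<close>
    then have "(F ^^ Suc n) ` X \<subseteq> B \<inter> X"
      using A(2,3) B(2) F by blast
    moreover have "measure lebesgue (B \<inter> X) \<le> measure lebesgue B"
      using B(1) X by (intro measure_mono_fmeasurable) (auto intro: lmeasurable_compact fmeasurableD)
    moreover have "measure lebesgue B \<le> \<theta> ^ Suc n * measure lebesgue X"
      using B(3) mult_left_mono[OF A(4) \<theta>(1)] by (simp add: mult.assoc)
    ultimately show ?case
      using B(1) X by (intro exI[of _ "B \<inter> X"]) (auto intro: compact_Int)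
  qed
  have "(F ^^ m) ` X \<subseteq> X" for m
    by (induction m) (use F in auto)
  then have mono: "(F ^^ (n + m)) ` X \<subseteq> (F ^^ n) ` X" for n m
    by (force simp: funpow_add)
  have sub: "nonwandering_set X F \<subseteq> B" if B: "compact B" "(F ^^ n) ` X \<subseteq> B" for B n
  proof
    fix x
    assume x: "x \<in> nonwandering_set X F"
    show "x \<in> B"
    proof (rule ccontr)
      assume "x \<notin> B"
      have "openin (top_of_set X) (X \<inter> - B)"
        using compact_imp_closed[OF B(1)] by (intro openin_open_Int) auto
      moreover have "x \<in> X \<inter> - B"
        using x \<open>x \<notin> B\<close> by (simp add: nonwandering_set_def)
      ultimately have "\<forall>n0\<ge>1. \<exists>m\<ge>n0. ((F ^^ m) -` (X \<inter> - B) \<inter> X) \<inter> (X \<inter> - B) \<noteq> {}"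
        using x unfolding nonwandering_set_def by blast
      \<comment> \<open>\<open>Suc n\<close> is an admissible \<open>n0\<close> even for
        \<open>n = 0\<close>.\<close>
      then obtain m where m: "m \<ge> Suc n" "((F ^^ m) -` (X \<inter> - B) \<inter> X) \<inter> (X \<inter> - B) \<noteq> {}"
        by (metis One_nat_def Suc_le_mono le0)
      then show False
        using mono[of n "m - n"] B(2) by auto
    qed
  qed
  have "negligible (nonwandering_set X F)"
    unfolding negligible_outer_le
  proof (intro allI impI)
    fix e :: real
    assume "e > 0"
    have "(\<lambda>n. \<theta> ^ n * measure lebesgue X) \<longlonglongrightarrow> 0"
      using \<theta> by (intro tendsto_mult_left_zero LIMSEQ_realpow_zero)
    then obtain n where n: "\<theta> ^ n * measure lebesgue X < e"
      using order_tendstoD(2)[OF _ \<open>e > 0\<close>] eventually_sequentially by (metis (mono_tags, lifting) order_refl)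
    obtain B where "compact B" "(F ^^ n) ` X \<subseteq> B" "measure lebesgue B \<le> \<theta> ^ n * measure lebesgue X"
      using iter by blast
    with n sub show "\<exists>T. nonwandering_set X F \<subseteq> T \<and> T \<in> lmeasurable \<and> measure lebesgue T \<le> e"
      by (intro exI[of _ B]) (auto intro: lmeasurable_compact)
  qed
  then show ?thesis
    by (simp add: negligible_iff_null_sets)
qed

section \<open>Compact covers of images under one application of the map\<close>

lemma cube_Icc: "cube {a..b} = cbox (\<chi> i. a) (\<chi> i. b)"
  by (auto simp: cube_def mem_box_cart)

text \<open>Supplies the contraction property required by \<open>nonwandering_set_null\<close>. A
  point of \<open>A\<close> either has a coordinate at a break point or selects one open piece per
  coordinate; the first kind is sent into a null set, the second is handled by the extended
  branches.\<close>

lemma coordinatewise_image_cover: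
  fixes h :: "real ^ 'n \<Rightarrow> real ^ 'n" and f :: "real \<Rightarrow> real"
  assumes h: "scales_measure q h" "continuous_on UNIV h" "q \<ge> 0"
    and f: "f ` {a..b} \<subseteq> {a..b}" "piecewise_C1_map {a..b} f"
    and C: "sup_abs_deriv {a..b} f \<le> ereal C" "C \<ge> 0"
    and A: "compact A" "A \<subseteq> cube {a..b}"
  shows "\<exists>B. compact B \<and> (\<lambda>x. h (\<chi> i. f (x $ i))) ` A \<subseteq> B \<and>
    measure lebesgue B \<le> q * C ^ CARD('n) * measure lebesgue A"
proof -
  obtain Q :: "real set set" and l u g where Q: "finite Q" "disjoint_family_on (\<lambda>J. {l J<..<u J}) Q"
    and E: "finite ({a..b} - (\<Union>J\<in>Q. {l J<..<u J}))"
    and lip: "\<forall>J\<in>Q. C-lipschitz_on {l J..u J} (g J)"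
    and g: "\<forall>J\<in>Q. \<forall>x\<in>{l J<..<u J}. g J x = f x"
    using piecewise_C1_map_lipschitz_pieces[OF f(2) C] by blast
  define E where "E = {a..b} - (\<Union>J\<in>Q. {l J<..<u J})"
  \<comment> \<open>If coordinate \<open>j\<close> sits at a break point \<open>e\<close>, then
    coordinate \<open>j\<close> of the image under \<open>f\<close> is \<open>f e\<close>. This
    leaves finitely many hyperplanes, cut down to the cube to be compact.\<close>
  define Z :: "(real^'n) set" where "Z = (\<Union>(j, e)\<in>UNIV \<times> E. cube {a..b} \<inter> {y. y $ j = f e})"
  have finE: "finite (UNIV \<times> E :: ('n \<times> real) set)"
    using E by (simp add: E_def)
  have Z_compact: "compact Z"
    unfolding Z_def cube_Icc
    by (intro compact_UN finE) (auto intro!: compact_Int_closed closed_Collect_eq continuous_intros)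
  have "negligible {y::real^'n. y $ j = r}" for j r
    using negligible_hyperplane[of "axis j 1 :: real^'n" r] by (simp add: inner_axis' axis_eq_0_iff)
  then have "negligible Z"
    unfolding Z_def using finE
    by (intro negligible_Union) (auto intro: negligible_Int)
  then have "measure lebesgue (h ` Z) = 0"
    using h(1) Z_compact
    by (simp add: scales_measure_def lmeasurable_compact negligible_imp_measure0)
  define S where "S = (UNIV :: 'n set) \<rightarrow>\<^sub>E Q"
  have "finite S"
    unfolding S_def using Q(1) by (intro finite_PiE) auto
  define lo hi where "lo = (\<lambda>\<sigma>. \<chi> i::'n. l (\<sigma> i))" and "hi = (\<lambda>\<sigma>. \<chi> i::'n. u (\<sigma> i))"
  define P where "P = (\<lambda>\<sigma> (x::real^'n). \<chi> i. g (\<sigma> i) (x $ i))"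
  define B where "B = (\<lambda>\<sigma>. h ` P \<sigma> ` (A \<inter> cbox (lo \<sigma>) (hi \<sigma>)))"
  have lip': "C-lipschitz_on {lo \<sigma> $ i..hi \<sigma> $ i} (g (\<sigma> i))" if "\<sigma> \<in> S" for \<sigma> i
    using that by (auto simp: S_def lo_def hi_def intro!: lip[rule_format])
  have A_cpt: "compact (A \<inter> cbox (lo \<sigma>) (hi \<sigma>))" for \<sigma>
    by (intro compact_Int A compact_cbox)
  have P_cpt: "compact (P \<sigma> ` (A \<inter> cbox (lo \<sigma>) (hi \<sigma>)))" if "\<sigma> \<in> S" for \<sigma>
    unfolding P_def using lip'[OF that] A_cpt
    by (intro compact_image_coordinatewise[where l = "lo \<sigma>" and u = "hi \<sigma>"])
      (auto intro: lipschitz_on_continuous_on)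
  have h_cpt: "compact (h ` K)" if "compact K" for K
    using that h(2) by (intro compact_continuous_image) (auto intro: continuous_on_subset)
  have B_cpt: "compact (B \<sigma>)" if "\<sigma> \<in> S" for \<sigma>
    unfolding B_def by (intro h_cpt P_cpt that)
  have A_box: "A \<inter> box (lo \<sigma>) (hi \<sigma>) \<in> lmeasurable" for \<sigma>
    by (intro fmeasurable.Int lmeasurable_compact A lmeasurable_box)
  \<comment> \<open>The cover uses closed boxes for compactness, but the bound is stated with open
    ones: these are disjoint for different choices of pieces, so their volumes within
    \<open>A\<close> sum to at most that of \<open>A\<close>. Box boundaries are null.\<close>
  have B_le: "measure lebesgue (B \<sigma>) \<le> q * C ^ CARD('n) * measure lebesgue (A \<inter> box (lo \<sigma>) (hi \<sigma>))"
    if "\<sigma> \<in> S" for \<sigma>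
  proof -
    have "measure lebesgue (B \<sigma>) = q * measure lebesgue (P \<sigma> ` (A \<inter> cbox (lo \<sigma>) (hi \<sigma>)))"
      using h(1) lmeasurable_compact[OF P_cpt[OF that]] by (simp add: scales_measure_def B_def)
    also have "\<dots> \<le> q * (C ^ CARD('n) * measure lebesgue (A \<inter> cbox (lo \<sigma>) (hi \<sigma>)))"
      unfolding P_def using lip'[OF that] A_cpt
      by (intro mult_left_mono measure_coordinatewise_lipschitz h(3)) auto
    also have "measure lebesgue (A \<inter> cbox (lo \<sigma>) (hi \<sigma>)) = measure lebesgue (A \<inter> box (lo \<sigma>) (hi \<sigma>))"
    proof (rule measure_negligible_symdiff[OF A_box])
      show "negligible (A \<inter> box (lo \<sigma>) (hi \<sigma>) - A \<inter> cbox (lo \<sigma>) (hi \<sigma>)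
          \<union> (A \<inter> cbox (lo \<sigma>) (hi \<sigma>) - A \<inter> box (lo \<sigma>) (hi \<sigma>)))"
        by (rule negligible_subset[OF negligible_frontier_interval[of "lo \<sigma>" "hi \<sigma>"]])
          (use box_subset_cbox in auto)
    qed
    finally show ?thesis
      by (simp add: mult.assoc)
  qed
  have "disjoint_family_on (\<lambda>\<sigma>. A \<inter> box (lo \<sigma>) (hi \<sigma>)) S"
    unfolding disjoint_family_on_def
  proof (intro ballI impI)
    fix \<sigma> \<tau>
    assume st: "\<sigma> \<in> S" "\<tau> \<in> S" "\<sigma> \<noteq> \<tau>"
    then obtain i where "\<sigma> i \<noteq> \<tau> i"
      by blast
    moreover have "\<sigma> i \<in> Q" "\<tau> i \<in> Q"
      using st by (auto simp: S_def)
    ultimately have "{l (\<sigma> i)<..<u (\<sigma> i)} \<inter> {l (\<tau> i)<..<u (\<tau> i)} = {}"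
      using Q(2) by (simp add: disjoint_family_on_def)
    moreover have "x $ i \<in> {l (\<sigma> i)<..<u (\<sigma> i)}" if "x \<in> box (lo \<sigma>) (hi \<sigma>)" for x \<sigma>
      using that by (simp add: mem_box_cart lo_def hi_def)
    ultimately show "(A \<inter> box (lo \<sigma>) (hi \<sigma>)) \<inter> (A \<inter> box (lo \<tau>) (hi \<tau>)) = {}"
      by blast
  qed
  then have "(\<Sum>\<sigma>\<in>S. measure lebesgue (A \<inter> box (lo \<sigma>) (hi \<sigma>)))
      = measure lebesgue (\<Union>\<sigma>\<in>S. A \<inter> box (lo \<sigma>) (hi \<sigma>))"
    using A_box[THEN fmeasurableD] A_box[THEN fmeasurableD2] \<open>finite S\<close>
    by (intro measure_finite_Union[symmetric]) (auto simp del: emeasure_completion)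
  also have "\<dots> \<le> measure lebesgue A"
  proof (rule measure_mono_fmeasurable)
    show "(\<Union>\<sigma>\<in>S. A \<inter> box (lo \<sigma>) (hi \<sigma>)) \<in> sets lebesgue"
      by (intro sets.finite_UN \<open>finite S\<close> fmeasurableD A_box)
  qed (use A(1) lmeasurable_compact in auto)
  finally have sum_le: "(\<Sum>\<sigma>\<in>S. measure lebesgue (A \<inter> box (lo \<sigma>) (hi \<sigma>))) \<le> measure lebesgue A" .
  show ?thesis
  proof (intro exI conjI)
    show "compact (h ` Z \<union> (\<Union>\<sigma>\<in>S. B \<sigma>))"
      by (intro compact_Un h_cpt Z_compact compact_UN \<open>finite S\<close> B_cpt)
    show "(\<lambda>x. h (\<chi> i. f (x $ i))) ` A \<subseteq> h ` Z \<union> (\<Union>\<sigma>\<in>S. B \<sigma>)"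
    proof (intro image_subsetI)
      fix x
      assume x: "x \<in> A"
      then have xab: "x $ i \<in> {a..b}" for i
        using A(2) by (auto simp: cube_def)
      show "h (\<chi> i. f (x $ i)) \<in> h ` Z \<union> (\<Union>\<sigma>\<in>S. B \<sigma>)"
      proof (cases "\<exists>j. x $ j \<in> E")
        case True
        then obtain j where j: "x $ j \<in> E" ..
        have "(\<chi> i. f (x $ i)) \<in> cube {a..b}"
          using xab f(1) by (auto simp: cube_def image_subset_iff)
        then have "(\<chi> i. f (x $ i)) \<in> Z"
          unfolding Z_def using j by (intro UN_I[of "(j, x $ j)"]) auto
        then show ?thesis
          by blast
      next
        case False
        then have "\<exists>J\<in>Q. x $ i \<in> {l J<..<u J}" for i
          using xab[of i] unfolding E_def by blast
        then obtain \<sigma> where \<sigma>: "\<And>i. \<sigma> i \<in> Q" "\<And>i. x $ i \<in> {l (\<sigma> i)<..<u (\<sigma> i)}"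
          by metis
        have "\<sigma> \<in> S" "x \<in> cbox (lo \<sigma>) (hi \<sigma>)"
          using \<sigma> by (auto simp: S_def mem_box_cart lo_def hi_def less_imp_le)
        moreover have "(\<chi> i. f (x $ i)) = P \<sigma> x"
          using \<sigma> by (simp add: P_def g)
        ultimately show ?thesis
          using x unfolding B_def by auto
      qed
    qed
    have "measure lebesgue (h ` Z \<union> (\<Union>\<sigma>\<in>S. B \<sigma>))
        \<le> measure lebesgue (h ` Z) + measure lebesgue (\<Union>\<sigma>\<in>S. B \<sigma>)"
      by (intro measure_Un_le fmeasurableD lmeasurable_compact h_cpt Z_compact compact_UN \<open>finite S\<close> B_cpt)
    also have "\<dots> \<le> (\<Sum>\<sigma>\<in>S. measure lebesgue (B \<sigma>))"
      using \<open>measure lebesgue (h ` Z) = 0\<close> \<open>finite S\<close> B_cpt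
      by (simp add: measure_UNION_le fmeasurableD lmeasurable_compact)
    also have "\<dots> \<le> (\<Sum>\<sigma>\<in>S. q * C ^ CARD('n) * measure lebesgue (A \<inter> box (lo \<sigma>) (hi \<sigma>)))"
      by (intro sum_mono B_le)
    also have "\<dots> \<le> q * C ^ CARD('n) * measure lebesgue A"
      using sum_le h(3) C(2) by (simp add: mult_left_mono flip: sum_distrib_left)
    finally show "measure lebesgue (h ` Z \<union> (\<Union>\<sigma>\<in>S. B \<sigma>)) \<le> q * C ^ CARD('n) * measure lebesgue A" .
  qed
qed

section \<open>Application to the reduced coupled map lattice\<close>

lemma reduced_map_eq_mean_field:
  "reduced_map N k \<epsilon> f c x = mean_field (1 - \<epsilon>) (\<epsilon> / real N) (real k) c (\<chi> i. f (x $ i))"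
  by (simp add: reduced_map_def mean_field_def)

text \<open>Each coordinate of the image is a convex combination of those of \<open>y\<close>: the
  weights are nonnegative with sum 1.\<close>

lemma mean_field_cube:
  fixes c :: "'n::finite"
  assumes "\<alpha> + \<beta> * (\<kappa> + real (CARD('n) - 1)) = 1" "\<alpha> \<ge> 0" "\<beta> \<ge> 0" "\<kappa> \<ge> 0"
    and y: "y \<in> cube {a..b}"
  shows "mean_field \<alpha> \<beta> \<kappa> c y \<in> cube {a..b}"
proof -
  have ab: "a \<le> y $ i" "y $ i \<le> b" for i
    using y by (auto simp: cube_def)
  have avg: "\<alpha> * t + \<beta> * (\<kappa> * t + (\<Sum>j\<in>UNIV - {c}. t)) = t" for t
  proof -
    have "\<alpha> * t + \<beta> * (\<kappa> * t + (\<Sum>j\<in>UNIV - {c}. t)) = (\<alpha> + \<beta> * (\<kappa> + real (CARD('n) - 1))) * t"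
      by (simp add: algebra_simps)
    then show ?thesis
      using assms(1) by simp
  qed
  have "\<alpha> * a + \<beta> * (\<kappa> * a + (\<Sum>j\<in>UNIV - {c}. a))
      \<le> \<alpha> * y $ i + \<beta> * (\<kappa> * y $ c + (\<Sum>j\<in>UNIV - {c}. y $ j))" for i
    using assms ab by (intro add_mono mult_left_mono sum_mono) auto
  moreover have "\<alpha> * y $ i + \<beta> * (\<kappa> * y $ c + (\<Sum>j\<in>UNIV - {c}. y $ j))
      \<le> \<alpha> * b + \<beta> * (\<kappa> * b + (\<Sum>j\<in>UNIV - {c}. b))" for i
    using assms ab by (intro add_mono mult_left_mono sum_mono) auto
  ultimately show ?thesis
    unfolding avg by (simp add: cube_def mean_field_def)
qed

theorem proposition5p1:
  fixes N k :: nat and \<epsilon> a b :: real and f :: "real \<Rightarrow> real" and c :: "'n::finite"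
  assumes "N \<ge> 2" and "k \<in> {2..N}" and "\<epsilon> \<in> {0..<1}" and "a \<le> b"
    and "f ` {a..b} \<subseteq> {a..b}"
    and "piecewise_C1_map {a..b} f"
    and "sup_abs_deriv {a..b} f
           < ereal ((1 - \<epsilon>) powr ((real k - real N) / real (N - k + 1)))"
    and "CARD('n) = N - k + 1"
  shows "nonwandering_set (cube {a..b}) (reduced_map N k \<epsilon> f c) \<in> null_sets lebesgue"
proof -
  let ?n = "CARD('n)" and ?e = "(real k - real N) / real (N - k + 1)"
  let ?L = "mean_field (1 - \<epsilon>) (\<epsilon> / real N) (real k) c"
  have \<epsilon>: "0 \<le> \<epsilon>" "0 < 1 - \<epsilon>"
    using assms(3) by auto
  have weights: "(1 - \<epsilon>) + \<epsilon> / real N * (real k + real (?n - 1)) = 1"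
    using assms(1,2,8) by (simp add: of_nat_diff)
  \<comment> \<open>The maximum with 0 makes \<open>C\<close> nonnegative; the supremum itself is
    minus infinity when its index set is empty, as for \<open>a = b\<close>.\<close>
  have "max (sup_abs_deriv {a..b} f) 0 < ereal ((1 - \<epsilon>) powr ?e)"
    using assms(7) \<epsilon> by simp
  then obtain C where C: "max (sup_abs_deriv {a..b} f) 0 < ereal C" "C < (1 - \<epsilon>) powr ?e"
    using ereal_dense2 by (metis ereal_less(2) less_ereal.simps(1))
  then have C': "sup_abs_deriv {a..b} f \<le> ereal C" "0 \<le> C"
    by auto
  have "C ^ ?n < ((1 - \<epsilon>) powr ?e) ^ ?n"
    using C(2) C'(2) by (intro power_strict_mono) auto
  also have "\<dots> = (1 - \<epsilon>) powr (?e * real ?n)"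
    using \<epsilon> by (simp add: powr_powr flip: powr_realpow)
  \<comment> \<open>With \<open>n = N - k + 1\<close> the exponent in the hypothesis is
    \<open>- (n - 1) / n\<close>, so the \<open>n\<close>-th power exactly cancels the determinant
    \<open>(1 - \<epsilon>) ^ (n - 1)\<close> of the linear part.\<close>
  also have "?e * real ?n = - real (?n - 1)"
    using assms(2,8) by (simp add: of_nat_diff)
  finally have "C ^ ?n < (1 - \<epsilon>) powr (- real (?n - 1))" .
  then have "(1 - \<epsilon>) ^ (?n - 1) * C ^ ?n < (1 - \<epsilon>) ^ (?n - 1) * (1 - \<epsilon>) powr (- real (?n - 1))"
    using \<epsilon> by (intro mult_strict_left_mono) auto
  also have "\<dots> = 1"
    using \<epsilon> unfolding powr_minus powr_realpow[OF \<epsilon>(2)] by simp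
  finally have less1: "(1 - \<epsilon>) ^ (?n - 1) * C ^ ?n < 1" .
  show ?thesis
  proof (rule nonwandering_set_null)
    show "compact (cube {a..b} :: (real^'n) set)"
      by (simp add: cube_Icc)
    show "reduced_map N k \<epsilon> f c ` cube {a..b} \<subseteq> cube {a..b}"
    proof (intro image_subsetI)
      fix x :: "real^'n"
      assume "x \<in> cube {a..b}"
      then have "(\<chi> i. f (x $ i)) \<in> cube {a..b}"
        using assms(5) by (auto simp: cube_def image_subset_iff)
      then show "reduced_map N k \<epsilon> f c x \<in> cube {a..b}"
        unfolding reduced_map_eq_mean_field using weights \<epsilon> by (intro mean_field_cube) auto
    qed
    show "0 \<le> (1 - \<epsilon>) ^ (?n - 1) * C ^ ?n"
      using \<epsilon> C'(2) by simp
    show "(1 - \<epsilon>) ^ (?n - 1) * C ^ ?n < 1"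
      by (rule less1)
    fix A :: "(real^'n) set"
    assume A: "compact A" "A \<subseteq> cube {a..b}"
    show "\<exists>B. compact B \<and> reduced_map N k \<epsilon> f c ` A \<subseteq> B \<and>
        measure lebesgue B \<le> (1 - \<epsilon>) ^ (?n - 1) * C ^ ?n * measure lebesgue A"
      unfolding reduced_map_eq_mean_field using weights \<epsilon>
      by (intro coordinatewise_image_cover[OF _ _ _ assms(5,6) C' A] scales_measure_mean_field
          continuous_on_mean_field) auto
  qed
qed

end
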